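(* Consider the $L^1$-minimization problem described in the context with the two-body potential $V(q)=-1/|q|$, $q\neq0$. Along a minimizing order two singular arc one has either $\alpha\in(\pi/2,\alpha_0]$ or $\alpha\in[-\alpha_0,-\pi/2)$ (the same alternative holding along the whole arc), where $\alpha$ is the angle of the control with the radial direction and $\alpha_0=\arccos(-1/\sqrt3)$.
   Context: Problem. Let $m\ge2$, $Q=\mathbf{R}^m\setminus\{0\}$, $X=TQ\simeq Q\times\mathbf{R}^m$, $x=(q,v)\in X$. The control system is $\ddot q(t)+\nabla V(q(t))=u(t)$, $|u(t)|\le1$ (Euclidean norm), with $v=\dot q$, $x(0)=x_0$, $x(t_f)\in X_f$, where $X_f\subset X$ is a submanifold not containing $x_0$ and invariant under the flow of the drift $F_0(q,v)=v\,\partial_q-\nabla V(q)\,\partial_v$, and $t_f$ is fixed and strictly larger than the (finite) minimum time from $x_0$ to $X_f$. One minimizes $\int_0^{t_f}|u(t)|\,dt$. The control is written $u=\rho w$ with $\rho\in[0,1]$ and $w\in\mathbf{S}^{m-1}$. Extremals. Extremals are normal (cost multiplier $p^0=-1$). They are integral curves $z=(q,v,p_q,p_v)$ in $T^*X$ of the Hamiltonian $H_0+\rho(t)H_1$, where $H_0=(p_q|v)-(p_v|\nabla V(q))$, $H_1=|p_v|-1$, $\rho(t)\in[0,1]$ maximizes $r\mapsto H_0+rH_1$ over $[0,1]$ for a.e. $t$, and $w=p_v/|p_v|$ when $p_v\ne0$. Singular arcs. A singular arc is a piece of extremal, on a time interval of positive length, along which $H_1$ vanishes identically (hence $|p_v|=1$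 and $w=p_v$). With the Poisson bracket $\{F,G\}$ equal to the derivative of $G$ along the Hamiltonian vector field of $F$, write $H_{01}=\{H_0,H_1\}$, $H_{001}=\{H_0,H_{01}\}$, $H_{0001}=\{H_0,H_{001}\}$, $H_{00001}=\{H_0,H_{0001}\}$, $H_{10001}=\{H_1,H_{0001}\}$. Along a singular arc one has $H_{01}=H_{001}=H_{0001}=0$. The arc is of order two if $H_{10001}\neq0$ along it, in which case $\rho=\rho_s:=-H_{00001}/H_{10001}$. A minimizing singular arc is one that is part of an extremal lift of a minimizing trajectory; the generalized Legendre condition $H_{10001}\le0$ holds along it. Angle. The angle $\alpha\in(-\pi,\pi]$ is the oriented angle from $q$ to the control direction $w=p_v$, in the plane spanned by $q$ and $p_v$, for a continuous choice of orientation along the arc; in particular $\cos\alpha=(p_v|q)/|q|$. *)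

theory Defs
  imports "HOL-Analysis.Analysis"
begin

section \<open>Hamiltonian calculus\<close>

text \<open>The configuration space is an open subset of a Euclidean space \<open>'a\<close>.  A state is
  \<open>x = (q, v)\<close> and a point of the cotangent bundle of the state space is
  \<open>z = (q, v, p\<^sub>q, p\<^sub>v)\<close>.\<close>

definition grad :: "('a::real_inner \<Rightarrow> real) \<Rightarrow> 'a \<Rightarrow> 'a" where
  "grad f x = (THE D. GDERIV f x :> D)"

type_synonym 'a cotangent = "'a \<times> 'a \<times> 'a \<times> 'a"

definition pos :: "'a cotangent \<Rightarrow> 'a" where "pos = (\<lambda>(q, v, pq, pv). q)"
definition state :: "'a cotangent \<Rightarrow> 'a \<times> 'a" where "state = (\<lambda>(q, v, pq, pv). (q, v))"
definition pv_of :: "'a cotangent \<Rightarrow> 'a" where "pv_of = (\<lambda>(q, v, pq, pv). pv)"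

definition ham_field :: "('a::euclidean_space cotangent \<Rightarrow> real) \<Rightarrow> 'a cotangent \<Rightarrow> 'a cotangent" where
  "ham_field F z = (case grad F z of (gq, gv, gpq, gpv) \<Rightarrow> (gpq, gpv, - gq, - gv))"

text \<open>Sign convention: the bracket of \<open>F\<close> and \<open>G\<close> is the derivative of \<open>G\<close> along the
  Hamiltonian field of \<open>F\<close>.  The functions used below are smooth on the open set
  \<open>q \<noteq> 0\<close>, \<open>p\<^sub>v \<noteq> 0\<close>; brackets carry no information elsewhere.\<close>

definition poisson ::
  "('a::euclidean_space cotangent \<Rightarrow> real) \<Rightarrow> ('a cotangent \<Rightarrow> real) \<Rightarrow> 'a cotangent \<Rightarrow> real" where
  "poisson F G z = frechet_derivative G (at z) (ham_field F z)"

definition H0 :: "('a::euclidean_space \<Rightarrow> real) \<Rightarrow> 'a cotangent \<Rightarrow> real" where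
  "H0 V = (\<lambda>(q, v, pq, pv). pq \<bullet> v - pv \<bullet> grad V q)"

definition H1 :: "'a::euclidean_space cotangent \<Rightarrow> real" where
  "H1 = (\<lambda>(q, v, pq, pv). norm pv - 1)"

definition H01 :: "('a::euclidean_space \<Rightarrow> real) \<Rightarrow> 'a cotangent \<Rightarrow> real" where
  "H01 V = poisson (H0 V) H1"

definition H001 :: "('a::euclidean_space \<Rightarrow> real) \<Rightarrow> 'a cotangent \<Rightarrow> real" where
  "H001 V = poisson (H0 V) (H01 V)"

definition H0001 :: "('a::euclidean_space \<Rightarrow> real) \<Rightarrow> 'a cotangent \<Rightarrow> real" where
  "H0001 V = poisson (H0 V) (H001 V)"

definition H10001 :: "('a::euclidean_space \<Rightarrow> real) \<Rightarrow> 'a cotangent \<Rightarrow> real" where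
  "H10001 V = poisson H1 (H0001 V)"

definition two_body :: "'a::euclidean_space \<Rightarrow> real" where
  "two_body q = - 1 / norm q"


section \<open>The control problem\<close>

definition state_space :: "('a::euclidean_space \<times> 'a) set" where
  "state_space = (- {0}) \<times> UNIV"

definition drift :: "('a::euclidean_space \<Rightarrow> real) \<Rightarrow> 'a \<times> 'a \<Rightarrow> 'a \<times> 'a" where
  "drift V = (\<lambda>(q, v). (v, - grad V q))"

text \<open>Absolutely continuous solutions of \<open>y' = f t y\<close> (almost everywhere) on \<open>[a, b]\<close>, in
  integral form.\<close>

definition caratheodory_solution ::
  "(real \<Rightarrow> 'b::euclidean_space \<Rightarrow> 'b) \<Rightarrow> real \<Rightarrow> real \<Rightarrow> (real \<Rightarrow> 'b) \<Rightarrow> bool" where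
  "caratheodory_solution f a b y \<longleftrightarrow>
     (\<lambda>s. f s (y s)) absolutely_integrable_on {a..b} \<and>
     (\<forall>t\<in>{a..b}. y t = y a + integral {a..t} (\<lambda>s. f s (y s)))"

definition admissible_control :: "real \<Rightarrow> (real \<Rightarrow> 'a::euclidean_space) \<Rightarrow> bool" where
  "admissible_control T u \<longleftrightarrow>
     u \<in> borel_measurable (lebesgue_on {0..T}) \<and> (\<forall>t\<in>{0..T}. norm (u t) \<le> 1)"

definition admissible ::
  "('a::euclidean_space \<Rightarrow> real) \<Rightarrow> 'a \<times> 'a \<Rightarrow> ('a \<times> 'a) set \<Rightarrow> real \<Rightarrow>
   (real \<Rightarrow> 'a \<times> 'a) \<Rightarrow> (real \<Rightarrow> 'a) \<Rightarrow> bool" where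
  "admissible V x0 Xf T x u \<longleftrightarrow>
     admissible_control T u \<and> (\<forall>t\<in>{0..T}. x t \<in> state_space) \<and>
     caratheodory_solution (\<lambda>t y. drift V y + (0, u t)) 0 T x \<and> x 0 = x0 \<and> x T \<in> Xf"

definition transfer_times ::
  "('a::euclidean_space \<Rightarrow> real) \<Rightarrow> 'a \<times> 'a \<Rightarrow> ('a \<times> 'a) set \<Rightarrow> real set" where
  "transfer_times V x0 Xf = {T. 0 \<le> T \<and> (\<exists>x u. admissible V x0 Xf T x u)}"

definition cost :: "real \<Rightarrow> (real \<Rightarrow> 'a::euclidean_space) \<Rightarrow> real" where
  "cost T u = integral {0..T} (\<lambda>t. norm (u t))"

definition minimizing ::
  "('a::euclidean_space \<Rightarrow> real) \<Rightarrow> 'a \<times> 'a \<Rightarrow> ('a \<times> 'a) set \<Rightarrow> real \<Rightarrow>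
   (real \<Rightarrow> 'a \<times> 'a) \<Rightarrow> (real \<Rightarrow> 'a) \<Rightarrow> bool" where
  "minimizing V x0 Xf T x u \<longleftrightarrow>
     admissible V x0 Xf T x u \<and>
     (\<forall>x' u'. admissible V x0 Xf T x' u' \<longrightarrow> cost T u \<le> cost T u')"

text \<open>Invariance is stated for arbitrary integral curves of the field inside the state space,
  forward and backward in time, since the flow need not be complete.\<close>

definition flow_invariant ::
  "('b::real_normed_vector \<Rightarrow> 'b) \<Rightarrow> 'b set \<Rightarrow> 'b set \<Rightarrow> bool" where
  "flow_invariant F X S \<longleftrightarrow>
     (\<forall>a b x. (\<forall>t\<in>{a..b}. x t \<in> X \<and> (x has_vector_derivative F (x t)) (at t within {a..b})) \<and>
        (\<exists>s\<in>{a..b}. x s \<in> S) \<longrightarrow> (\<forall>t\<in>{a..b}. x t \<in> S))"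

primrec Ck :: "nat \<Rightarrow> 'a::euclidean_space set \<Rightarrow> ('a \<Rightarrow> 'b::euclidean_space) \<Rightarrow> bool" where
  "Ck 0 U f \<longleftrightarrow> continuous_on U f"
| "Ck (Suc k) U f \<longleftrightarrow>
     (\<forall>x\<in>U. f differentiable (at x)) \<and> (\<forall>h. Ck k U (\<lambda>x. frechet_derivative f (at x) h))"

definition diffeomorphism ::
  "'a::euclidean_space set \<Rightarrow> 'a set \<Rightarrow> ('a \<Rightarrow> 'a) \<Rightarrow> ('a \<Rightarrow> 'a) \<Rightarrow> bool" where
  "diffeomorphism U W \<phi> \<psi> \<longleftrightarrow>
     open U \<and> open W \<and> homeomorphism U W \<phi> \<psi> \<and> (\<forall>k. Ck k U \<phi>) \<and> (\<forall>k. Ck k W \<psi>)"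

text \<open>Smooth embedded submanifolds without boundary, via straightening charts of the ambient
  space.  The dimension is not required to be the same on all components.\<close>

definition submanifold :: "'a::euclidean_space set \<Rightarrow> bool" where
  "submanifold M \<longleftrightarrow>
     (\<forall>x\<in>M. \<exists>U W \<phi> \<psi> L. x \<in> U \<and> diffeomorphism U W \<phi> \<psi> \<and> subspace L \<and> \<phi> ` (U \<inter> M) = W \<inter> L)"


section \<open>Extremals and singular arcs\<close>

text \<open>Normal extremals of the control \<open>u = \<rho> w\<close>.  Where \<open>p\<^sub>v = 0\<close> the function \<open>H1\<close> is not
  differentiable, but there the maximum condition forces \<open>\<rho> = 0\<close> and the Hamiltonian
  reduces to \<open>H0\<close>.\<close>

definition extremal ::
  "('a::euclidean_space \<Rightarrow> real) \<Rightarrow> real \<Rightarrow> (real \<Rightarrow> 'a cotangent) \<Rightarrow> (real \<Rightarrow> real) \<Rightarrow>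
   (real \<Rightarrow> 'a) \<Rightarrow> bool" where
  "extremal V T z \<rho> w \<longleftrightarrow>
     \<rho> \<in> borel_measurable (lebesgue_on {0..T}) \<and> w \<in> borel_measurable (lebesgue_on {0..T}) \<and>
     (\<forall>t\<in>{0..T}. \<rho> t \<in> {0..1} \<and> norm (w t) = 1 \<and> pos (z t) \<noteq> 0) \<and>
     caratheodory_solution (\<lambda>t. ham_field (\<lambda>y. H0 V y + \<rho> t * H1 y)) 0 T z \<and>
     (AE t in lebesgue_on {0..T}. \<forall>r\<in>{0..1}.
        H0 V (z t) + r * H1 (z t) \<le> H0 V (z t) + \<rho> t * H1 (z t)) \<and>
     (AE t in lebesgue_on {0..T}. pv_of (z t) \<noteq> 0 \<longrightarrow> w t = pv_of (z t) /\<^sub>R norm (pv_of (z t)))"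

definition singular_arc :: "real \<Rightarrow> (real \<Rightarrow> 'a::euclidean_space cotangent) \<Rightarrow> real set \<Rightarrow> bool" where
  "singular_arc T z I \<longleftrightarrow>
     is_interval I \<and> I \<subseteq> {0..T} \<and> (\<exists>a\<in>I. \<exists>b\<in>I. a < b) \<and> (\<forall>t\<in>I. H1 (z t) = 0)"

definition order_two ::
  "('a::euclidean_space \<Rightarrow> real) \<Rightarrow> (real \<Rightarrow> 'a cotangent) \<Rightarrow> real set \<Rightarrow> bool" where
  "order_two V z I \<longleftrightarrow> (\<forall>t\<in>I. H10001 V (z t) \<noteq> 0)"


section \<open>Oriented angles along an arc\<close>

text \<open>The oriented angle in \<open>(-pi, pi]\<close> from \<open>a\<close> to \<open>b\<close>, nonzero vectors of the plane oriented
  by the orthonormal frame \<open>(e1, e2)\<close>; it depends on the frame only through the orientation.\<close>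

definition oriented_angle :: "'a::euclidean_space \<Rightarrow> 'a \<Rightarrow> 'a \<Rightarrow> 'a \<Rightarrow> real" where
  "oriented_angle e1 e2 a b =
     Arg (Complex (b \<bullet> e1) (b \<bullet> e2) / Complex (a \<bullet> e1) (a \<bullet> e2))"

text \<open>A continuous choice of orientation of the plane spanned by \<open>q t\<close> and \<open>p t\<close>, given by a
  continuous orthonormal frame.  Linear independence of \<open>q t\<close> and \<open>p t\<close> is not assumed here.\<close>

definition continuous_orientation ::
  "real set \<Rightarrow> (real \<Rightarrow> 'a::euclidean_space) \<Rightarrow> (real \<Rightarrow> 'a) \<Rightarrow> (real \<Rightarrow> 'a) \<Rightarrow> (real \<Rightarrow> 'a) \<Rightarrow> bool" where
  "continuous_orientation I q p e1 e2 \<longleftrightarrow>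
     continuous_on I e1 \<and> continuous_on I e2 \<and>
     (\<forall>t\<in>I. norm (e1 t) = 1 \<and> norm (e2 t) = 1 \<and> e1 t \<bullet> e2 t = 0 \<and>
            q t \<in> span {e1 t, e2 t} \<and> p t \<in> span {e1 t, e2 t})"

end

theory Submission
  imports Defs
begin

text \<open>Write \<open>p = p\<^sub>v\<close>, \<open>c = cos \<alpha> = (q \<bullet> p) / |q|\<close> on a singular arc, where \<open>|p| = 1\<close>.

  The two bounds on \<open>c\<close> come from two different places.  The bound \<open>c\<^sup>2 \<le> 1/3\<close> is kinematic:
  the adjoint equations are \<open>p' = - p\<^sub>q\<close> and \<open>p\<^sub>q' = V''(q) p\<close>, so differentiating the identity
  \<open>|p|\<^sup>2 = 1\<close> twice gives \<open>p\<^sub>q \<bullet> p = 0\<close> and then \<open>V''(q)(p, p) = |p\<^sub>q|\<^sup>2\<close> (these are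
  \<open>H01 = 0\<close> and \<open>H001 = 0\<close>).  For the two-body potential
  \<open>V''(q)(p, p) = (1 - 3 c\<^sup>2) / |q|\<^sup>3\<close>, and this must be nonnegative.  The sign of \<open>c\<close> comes from
  the Legendre condition: one computes \<open>H10001 = - V'''(q)(p, p, p) = 3 c (3 - 5 c\<^sup>2) / |q|\<^sup>4\<close>,
  the second factor is positive because \<open>c\<^sup>2 \<le> 1/3\<close>, and the Legendre inequality is strict on
  an arc of order two, so \<open>c < 0\<close>.  Hence \<open>- 1 / sqrt 3 \<le> c < 0\<close> pointwise: see \<open>singular_arc_conditions\<close>,
  \<open>H10001_eq\<close> and \<open>radial_cosine_bounds\<close>.

  In particular \<open>q\<close> and \<open>p\<close> are never collinear.  So Gram-Schmidt provides a continuous frame of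
  their plane (\<open>continuous_orientation_exists\<close>), and for any such frame \<open>sin \<alpha>\<close> has the sign of a
  continuous function without zeros on the interval, which therefore keeps the angle on one side of
  the radial direction (\<open>oriented_angle_constant_side\<close>).\<close>

section \<open>Derivatives of the two-body potential\<close>

text \<open>The derivatives of \<open>|q|\<close> and \<open>1/|q|\<close> are polynomial in \<open>1/|q|\<close> and inner products.
  With \<open>1/|q|\<close> as an opaque constant all the derivatives below are polynomial identities, which
  ring normalization decides, and the general rules for inverses do not interfere.\<close>

definition recip_norm :: "'a::real_normed_vector \<Rightarrow> real" where
  "recip_norm x = inverse (norm x)"

lemma has_derivative_norm_nonzero:
  fixes g :: "'b::real_normed_vector \<Rightarrow> 'a::real_inner"
  assumes "(g has_derivative g') (at x within S)" "g x \<noteq> 0"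
  shows "((\<lambda>y. norm (g y)) has_derivative (\<lambda>h. (g x \<bullet> g' h) * recip_norm (g x))) (at x within S)"
  using has_derivative_compose[OF assms(1) has_derivative_norm[OF assms(2)]]
  by (simp add: sgn_div_norm inner_commute mult.commute recip_norm_def)

lemma has_derivative_recip_norm:
  fixes g :: "'b::real_normed_vector \<Rightarrow> 'a::real_inner"
  assumes "(g has_derivative g') (at x within S)" "g x \<noteq> 0"
  shows "((\<lambda>y. recip_norm (g y)) has_derivative
    (\<lambda>h. - ((g x \<bullet> g' h) * recip_norm (g x) ^ 3))) (at x within S)"
  using Deriv.has_derivative_inverse[OF _ has_derivative_norm_nonzero[OF assms]] assms
  by (simp add: recip_norm_def[symmetric] power3_eq_cube ac_simps)

lemma grad_eq: "GDERIV f x :> D \<Longrightarrow> grad f x = D" for x D :: "'a::euclidean_space"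
  unfolding grad_def
proof (rule the_equality)
  fix E assume "GDERIV f x :> D" "GDERIV f x :> E"
  then have "(\<lambda>h. h \<bullet> E) = (\<lambda>h. h \<bullet> D)"
    unfolding gderiv_def using has_derivative_unique by blast
  then show "E = D"
    by (meson vector_eq_ldot)
qed

lemma two_body_eq: "two_body = (\<lambda>q :: 'a::euclidean_space. - recip_norm q)"
  by (simp add: fun_eq_iff two_body_def recip_norm_def inverse_eq_divide)

lemma grad_two_body:
  fixes q :: "'a::euclidean_space"
  assumes "q \<noteq> 0"
  shows "grad two_body q = (recip_norm q ^ 3) *\<^sub>R q"
proof (rule grad_eq)
  have "((\<lambda>q. - recip_norm q) has_derivative (\<lambda>h. h \<bullet> ((recip_norm q ^ 3) *\<^sub>R q))) (at q)"
    by (rule has_derivative_eq_rhs, (rule derivative_intros has_derivative_recip_norm assms)+)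
      (simp add: fun_eq_iff inner_commute mult.commute)
  then show "GDERIV two_body q :> (recip_norm q ^ 3) *\<^sub>R q"
    by (simp only: gderiv_def two_body_eq)
qed

text \<open>The vector \<open>V''(q) p\<close> for the two-body potential.\<close>

definition kepler_hess :: "'a::euclidean_space \<Rightarrow> 'a \<Rightarrow> 'a" where
  "kepler_hess q p = (recip_norm q ^ 3) *\<^sub>R p - (3 * (q \<bullet> p) * recip_norm q ^ 5) *\<^sub>R q"

text \<open>The third derivative \<open>V'''(q)(v, p, p)\<close> for the two-body potential.\<close>

definition kepler_third :: "'a::euclidean_space \<Rightarrow> 'a \<Rightarrow> 'a \<Rightarrow> real" where
  "kepler_third q v p = - 3 * (q \<bullet> v) * (p \<bullet> p) * recip_norm q ^ 5
     - 6 * (q \<bullet> p) * (v \<bullet> p) * recip_norm q ^ 5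
     + 15 * (q \<bullet> p)^2 * (q \<bullet> v) * recip_norm q ^ 7"

text \<open>The form \<open>V''(q)(p, p)\<close> enters \<open>H001\<close>, and differentiating it once more brings in the third
  derivative of the potential; the factor 2 reflects the symmetry of \<open>V''(q)\<close>.\<close>

lemma has_derivative_tidal_form:
  fixes f g :: "'b::real_normed_vector \<Rightarrow> 'a::euclidean_space"
  assumes "(f has_derivative f') (at x)" "(g has_derivative g') (at x)" "f x \<noteq> 0"
  shows "((\<lambda>y. kepler_hess (f y) (g y) \<bullet> g y) has_derivative
    (\<lambda>h. kepler_third (f x) (f' h) (g x) + 2 * (kepler_hess (f x) (g' h) \<bullet> g x))) (at x)"
proof -
  have "((\<lambda>y. recip_norm (f y) ^ 3 * (g y \<bullet> g y) - 3 * (f y \<bullet> g y)^2 * recip_norm (f y) ^ 5) has_derivative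
    (\<lambda>h. kepler_third (f x) (f' h) (g x) + 2 * (kepler_hess (f x) (g' h) \<bullet> g x))) (at x)"
    by (rule has_derivative_eq_rhs, (rule derivative_intros has_derivative_recip_norm assms)+)
      (simp add: fun_eq_iff kepler_third_def kepler_hess_def inner_simps inner_commute,
        simp add: algebra_simps power_numeral_reduce)
  moreover have "kepler_hess a b \<bullet> b = recip_norm a ^ 3 * (b \<bullet> b) - 3 * (a \<bullet> b)^2 * recip_norm a ^ 5" for a b :: 'a
    by (simp add: kepler_hess_def inner_diff_left power2_eq_square)
  ultimately show ?thesis
    by simp
qed

section \<open>Hamiltonian fields and iterated brackets\<close>

text \<open>The open set on which the Hamiltonians are smooth.  A bracket at one of its points depends
  only on the restriction of the second function to this set, so closed formulas that hold there
  may be differentiated again.\<close>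

definition regular :: "'a::euclidean_space cotangent set" where
  "regular = {(q, v, pq, pv). q \<noteq> 0 \<and> pv \<noteq> 0}"

lemma open_regular: "open (regular :: 'a::euclidean_space cotangent set)"
proof -
  have *: "regular = (- {0 :: 'a}) \<times> (UNIV :: 'a set) \<times> (UNIV :: 'a set) \<times> (- {0 :: 'a})"
    by (auto simp: regular_def)
  show ?thesis
    unfolding * by (intro open_Times open_UNIV open_Compl closed_singleton)
qed

lemma has_derivative_regular:
  fixes F G :: "'a::euclidean_space cotangent \<Rightarrow> real"
  assumes "(G has_derivative D) (at z)" "z \<in> regular" "\<And>y. y \<in> regular \<Longrightarrow> F y = G y"
  shows "(F has_derivative D) (at z)"
  using has_derivative_transform_within_open[OF assms(1) open_regular assms(2)] assms(3) by simp

lemma poisson_regular: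
  fixes F G G' :: "'a::euclidean_space cotangent \<Rightarrow> real"
  assumes "(G' has_derivative D) (at z)" "z \<in> regular" "\<And>y. y \<in> regular \<Longrightarrow> G y = G' y"
  shows "poisson F G z = D (ham_field F z)"
  using frechet_derivative_at[OF has_derivative_regular[OF assms]] by (simp add: poisson_def)

lemma ham_field_eq:
  "GDERIV F z :> (gq, gv, gpq, gpv) \<Longrightarrow> ham_field F z = (gpq, gpv, - gq, - gv)"
  by (simp add: ham_field_def grad_eq)

text \<open>The general combination serves three times: the field of \<open>H0\<close>, the field of \<open>H1\<close>, and the
  field \<open>H0 + \<rho> H1\<close> of an extremal.\<close>

lemma ham_field_control:
  fixes q v pq pv :: "'a::euclidean_space"
  assumes "q \<noteq> 0" "pv \<noteq> 0"
  shows "ham_field (\<lambda>y. a * H0 two_body y + r * H1 y) (q, v, pq, pv) =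
    (a *\<^sub>R v, - ((a * recip_norm q ^ 3) *\<^sub>R q) + (r * recip_norm pv) *\<^sub>R pv, a *\<^sub>R kepler_hess q pv, - (a *\<^sub>R pq))"
proof -
  let ?G = "\<lambda>y. a * (fst (snd (snd y)) \<bullet> fst (snd y) - (snd (snd (snd y)) \<bullet> fst y) * recip_norm (fst y) ^ 3)
        + r * (norm (snd (snd (snd y))) - 1)"
  let ?g = "(- (a *\<^sub>R kepler_hess q pv), a *\<^sub>R pq, a *\<^sub>R v, - ((a * recip_norm q ^ 3) *\<^sub>R q) + (r * recip_norm pv) *\<^sub>R pv)"
  have "(?G has_derivative (\<lambda>h. h \<bullet> ?g)) (at (q, v, pq, pv))"
    by (rule has_derivative_eq_rhs, (rule derivative_intros has_derivative_recip_norm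
          has_derivative_norm_nonzero | simp add: assms)+)
      (simp add: fun_eq_iff kepler_hess_def inner_diff_left inner_diff_right inner_add_left
          inner_add_right inner_commute, simp add: algebra_simps power_numeral_reduce)
  then have "((\<lambda>y. a * H0 two_body y + r * H1 y) has_derivative (\<lambda>h. h \<bullet> ?g)) (at (q, v, pq, pv))"
    by (rule has_derivative_regular) (use assms in \<open>auto simp: regular_def H0_def H1_def grad_two_body\<close>)
  then show ?thesis
    using ham_field_eq unfolding gderiv_def by fastforce
qed

lemma ham_field_H0:
  assumes "q \<noteq> 0" "pv \<noteq> 0"
  shows "ham_field (H0 two_body) (q, v, pq, pv) =
    (v, - ((recip_norm q ^ 3) *\<^sub>R q), kepler_hess q pv, - pq)"
  using ham_field_control[OF assms, of 1 0 v pq] by simp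

lemma ham_field_H1:
  assumes "q \<noteq> 0" "pv \<noteq> 0"
  shows "ham_field H1 (q, v, pq, pv) = (0, recip_norm pv *\<^sub>R pv, 0, 0)"
  using ham_field_control[OF assms, of 0 1 v pq] by simp

text \<open>The next three formulas are obtained by differentiating along \<open>q' = v\<close>, \<open>v' = - \<nabla>V(q)\<close>,
  \<open>p\<^sub>q' = V''(q) p\<^sub>v\<close>, \<open>p\<^sub>v' = - p\<^sub>q\<close>.  They must hold on the whole open set and not only where the
  lower brackets vanish, because each one is differentiated to get the next.\<close>

lemma H01_eq:
  assumes "q \<noteq> 0" "pv \<noteq> 0"
  shows "H01 two_body (q, v, pq, pv) = - (pq \<bullet> pv) * recip_norm pv"
proof -
  have h: "((\<lambda>y. norm (snd (snd (snd y))) - 1) has_derivative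
     (\<lambda>h. (pv \<bullet> snd (snd (snd h))) * recip_norm pv)) (at (q, v, pq, pv))"
    by (rule has_derivative_eq_rhs,
        (rule has_derivative_norm_nonzero derivative_intros | simp add: assms)+)
  show ?thesis
    unfolding H01_def
    by (subst poisson_regular[OF h])
      (use assms in \<open>auto simp: regular_def H1_def ham_field_H0 inner_commute\<close>)
qed

lemma H001_eq:
  assumes "q \<noteq> 0" "pv \<noteq> 0"
  shows "H001 two_body (q, v, pq, pv) =
    - (kepler_hess q pv \<bullet> pv - pq \<bullet> pq) * recip_norm pv - (pq \<bullet> pv)^2 * recip_norm pv ^ 3"
proof -
  have h: "((\<lambda>y. - (fst (snd (snd y)) \<bullet> snd (snd (snd y))) * recip_norm (snd (snd (snd y)))) has_derivative
     (\<lambda>h. - (pq \<bullet> snd (snd (snd h)) + fst (snd (snd h)) \<bullet> pv) * recip_norm pv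
        + (pq \<bullet> pv) * (pv \<bullet> snd (snd (snd h))) * recip_norm pv ^ 3)) (at (q, v, pq, pv))"
    by (rule has_derivative_eq_rhs,
        (rule has_derivative_recip_norm derivative_intros | simp add: assms)+)
      (simp add: fun_eq_iff algebra_simps)
  show ?thesis
    unfolding H001_def
    by (subst poisson_regular[OF h])
      (use assms in \<open>auto simp: regular_def H01_eq ham_field_H0 inner_commute algebra_simps power2_eq_square\<close>)
qed

lemma H0001_eq:
  assumes "q \<noteq> 0" "pv \<noteq> 0"
  shows "H0001 two_body (q, v, pq, pv) =
    - (kepler_third q v pv - 4 * (kepler_hess q pq \<bullet> pv)) * recip_norm pv
    - 3 * (pq \<bullet> pv) * (kepler_hess q pv \<bullet> pv - pq \<bullet> pq) * recip_norm pv ^ 3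
    - 3 * (pq \<bullet> pv) ^ 3 * recip_norm pv ^ 5"
proof -
  have h: "((\<lambda>y. - (kepler_hess (fst y) (snd (snd (snd y))) \<bullet> snd (snd (snd y)) - fst (snd (snd y)) \<bullet> fst (snd (snd y)))
          * recip_norm (snd (snd (snd y)))
         - (fst (snd (snd y)) \<bullet> snd (snd (snd y)))^2 * recip_norm (snd (snd (snd y)))^3) has_derivative
     (\<lambda>h. - (kepler_third q (fst h) pv + 2 * (kepler_hess q (snd (snd (snd h))) \<bullet> pv) - 2 * (pq \<bullet> fst (snd (snd h)))) * recip_norm pv
        + (kepler_hess q pv \<bullet> pv - pq \<bullet> pq) * (pv \<bullet> snd (snd (snd h))) * recip_norm pv ^ 3
        - 2 * (pq \<bullet> pv) * (pq \<bullet> snd (snd (snd h)) + fst (snd (snd h)) \<bullet> pv) * recip_norm pv ^ 3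
        + 3 * (pq \<bullet> pv)^2 * (pv \<bullet> snd (snd (snd h))) * recip_norm pv ^ 5)) (at (q, v, pq, pv))"
    by (rule has_derivative_eq_rhs,
        (rule has_derivative_tidal_form has_derivative_recip_norm derivative_intros | simp add: assms)+)
      (simp add: fun_eq_iff inner_commute algebra_simps power_numeral_reduce)
  have hess_minus: "kepler_hess q (- pq) = - kepler_hess q pq"
    by (simp add: kepler_hess_def)
  have hess_sym: "kepler_hess q pv \<bullet> pq = kepler_hess q pq \<bullet> pv"
    by (simp add: kepler_hess_def inner_diff_left inner_commute[of pq pv])
  show ?thesis
    unfolding H0001_def
    by (subst poisson_regular[OF h])
      (use assms hess_sym in \<open>auto simp: regular_def H001_eq ham_field_H0 hess_minus inner_commute
        algebra_simps power_numeral_reduce\<close>)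
qed

text \<open>The field of \<open>H1\<close> moves only \<open>v\<close>, and \<open>H0001\<close> contains \<open>v\<close> only in the linear term
  \<open>- V'''(q)(v, p\<^sub>v, p\<^sub>v) / |p\<^sub>v|\<close>.\<close>

lemma H10001_eq:
  assumes "q \<noteq> 0" "pv \<noteq> 0"
  shows "H10001 two_body (q, v, pq, pv) = - kepler_third q pv pv * recip_norm pv ^ 2"
proof -
  let ?G = "\<lambda>y. - (kepler_third (fst y) (fst (snd y)) (snd (snd (snd y)))
      - 4 * (kepler_hess (fst y) (fst (snd (snd y))) \<bullet> snd (snd (snd y)))) * recip_norm (snd (snd (snd y)))
    - 3 * (fst (snd (snd y)) \<bullet> snd (snd (snd y)))
      * (kepler_hess (fst y) (snd (snd (snd y))) \<bullet> snd (snd (snd y)) - fst (snd (snd y)) \<bullet> fst (snd (snd y)))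
      * recip_norm (snd (snd (snd y))) ^ 3
    - 3 * (fst (snd (snd y)) \<bullet> snd (snd (snd y))) ^ 3 * recip_norm (snd (snd (snd y))) ^ 5"
  have "\<exists>D. (?G has_derivative D) (at (q, v, pq, pv))
    \<and> (\<forall>k. D (0, k, 0, 0) = - kepler_third q k pv * recip_norm pv)"
    unfolding kepler_third_def kepler_hess_def
    by (rule exI, rule conjI, (rule has_derivative_recip_norm derivative_intros | simp add: assms)+)
  then obtain D where G: "(?G has_derivative D) (at (q, v, pq, pv))"
    and D: "\<And>k. D (0, k, 0, 0) = - kepler_third q k pv * recip_norm pv"
    by blast
  show ?thesis
    unfolding H10001_def
    by (subst poisson_regular[OF G])
      (use assms in \<open>auto simp: regular_def H0001_eq ham_field_H1 D kepler_third_def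
        algebra_simps power_numeral_reduce\<close>)
qed

section \<open>Absolutely continuous solutions\<close>

lemma caratheodory_continuous:
  assumes "caratheodory_solution f a b y"
  shows "continuous_on {a..b} y"
proof -
  have "continuous_on {a..b} (\<lambda>t. y a + integral {a..t} (\<lambda>s. f s (y s)))"
    using assms unfolding caratheodory_solution_def
    by (intro continuous_intros indefinite_integral_continuous_1 set_lebesgue_integral_eq_integral(1)) auto
  moreover have "continuous_on {a..b} y
      \<longleftrightarrow> continuous_on {a..b} (\<lambda>t. y a + integral {a..t} (\<lambda>s. f s (y s)))"
    using assms unfolding caratheodory_solution_def by (intro continuous_on_cong) blast+
  ultimately show ?thesis
    by simp
qed

text \<open>An absolutely continuous solution has a derivative only almost everywhere, since the control
  may be merely measurable.  But a linear component whose velocity happens to be continuous along the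
  solution is continuously differentiable; on a singular arc this applies to \<open>p\<^sub>q\<close> and \<open>p\<^sub>v\<close>,
  whose equations do not contain the control.\<close>

lemma caratheodory_component_derivative:
  fixes y :: "real \<Rightarrow> 'b::euclidean_space" and L :: "'b \<Rightarrow> 'c::banach"
  assumes sol: "caratheodory_solution f a b y" and L: "bounded_linear L"
    and sub: "{c..d} \<subseteq> {a..b}" and g: "continuous_on {c..d} g"
    and eq: "\<And>s. s \<in> {c..d} \<Longrightarrow> L (f s (y s)) = g s"
    and t: "t \<in> {c..d}"
  shows "((\<lambda>s. L (y s)) has_vector_derivative g t) (at t within {c..d})"
proof -
  let ?f = "\<lambda>s. f s (y s)"
  have int: "?f integrable_on {a..b}"
    using sol set_lebesgue_integral_eq_integral(1) unfolding caratheodory_solution_def by blast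
  have rep: "y s = y a + integral {a..s} ?f" if "s \<in> {a..b}" for s
    using sol that unfolding caratheodory_solution_def by blast
  have c: "c \<in> {a..b}" using sub t by auto
  have rep_L: "L (y s) = L (y c) + integral {c..s} g" if s: "s \<in> {c..d}" for s
  proof -
    have sab: "s \<in> {a..b}" using s sub by auto
    have cs: "?f integrable_on {c..s}"
      using int by (rule integrable_subinterval_real) (use c sab in auto)
    have "integral {a..s} ?f = integral {a..c} ?f + integral {c..s} ?f"
      using c s sab by (intro Henstock_Kurzweil_Integration.integral_combine[symmetric] integrable_subinterval_real[OF int]) auto
    then have "y s = y c + integral {c..s} ?f"
      by (metis rep[OF sab] rep[OF c] add.assoc)
    then have "L (y s) = L (y c) + L (integral {c..s} ?f)"
      by (metis L bounded_linear.linear linear_add)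
    also have "L (integral {c..s} ?f) = integral {c..s} (L \<circ> ?f)"
      by (rule integral_linear[OF cs L, symmetric])
    also have "integral {c..s} (L \<circ> ?f) = integral {c..s} g"
      by (rule integral_cong) (use eq s in auto)
    finally show ?thesis .
  qed
  have deriv: "((\<lambda>s. L (y c) + integral {c..s} g) has_vector_derivative g t) (at t within {c..d})"
    using has_vector_derivative_add[OF has_vector_derivative_const integral_has_vector_derivative[OF g t]]
    by simp
  show ?thesis
    by (rule has_vector_derivative_transform[OF t _ deriv]) (rule rep_L)
qed

lemma derivative_zero_of_constant:
  fixes f :: "real \<Rightarrow> 'a::real_normed_vector"
  assumes "(f has_vector_derivative D) (at t within {a..b})" "t \<in> {a..b}" "a < b"
    and "\<And>s. s \<in> {a..b} \<Longrightarrow> f s = k"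
  shows "D = 0"
proof (rule vector_derivative_unique_within)
  show "at t within {a..b} \<noteq> bot"
    using assms by (simp add: trivial_limit_within islimpt_Icc)
  show "(f has_vector_derivative D) (at t within {a..b})" by fact
  show "(f has_vector_derivative 0) (at t within {a..b})"
    by (rule has_vector_derivative_transform[OF assms(2) assms(4) has_vector_derivative_const])
qed

section \<open>Oriented angles in a moving plane\<close>

lemma orthonormal_pair_expansion:
  fixes e1 e2 x :: "'a::real_inner"
  assumes "norm e1 = 1" "norm e2 = 1" "e1 \<bullet> e2 = 0" "x \<in> span {e1, e2}"
  shows "x = (x \<bullet> e1) *\<^sub>R e1 + (x \<bullet> e2) *\<^sub>R e2"
proof -
  obtain a b where x: "x = a *\<^sub>R e1 + b *\<^sub>R e2"
    using assms(4) by (auto simp: span_insert span_singleton algebra_simps)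
  have "e1 \<bullet> e1 = 1" "e2 \<bullet> e2 = 1"
    using assms by (auto simp: dot_square_norm)
  then show ?thesis
    using assms(3) by (simp add: x inner_simps inner_commute)
qed

lemma
  fixes e1 e2 a b :: "'a::euclidean_space"
  assumes e: "norm e1 = 1" "norm e2 = 1" "e1 \<bullet> e2 = 0"
    and a: "a \<in> span {e1, e2}" "a \<noteq> 0" and b: "b \<in> span {e1, e2}" "b \<noteq> 0"
  shows cos_oriented_angle: "cos (oriented_angle e1 e2 a b) = (a \<bullet> b) / (norm a * norm b)"
    and sin_oriented_angle: "sin (oriented_angle e1 e2 a b) =
      ((a \<bullet> e1) * (b \<bullet> e2) - (a \<bullet> e2) * (b \<bullet> e1)) / (norm a * norm b)"
proof -
  have ee: "e1 \<bullet> e1 = 1" "e2 \<bullet> e2 = 1" "e2 \<bullet> e1 = 0"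
    using e by (auto simp: dot_square_norm inner_commute)
  have ip: "x \<bullet> y = (x \<bullet> e1) * (y \<bullet> e1) + (x \<bullet> e2) * (y \<bullet> e2)"
    if "x \<in> span {e1, e2}" for x y
    by (subst orthonormal_pair_expansion[OF e that]) (simp add: inner_add_left inner_commute[of e1 y] inner_commute[of e2 y])
  define A B where "A = Complex (a \<bullet> e1) (a \<bullet> e2)" and "B = Complex (b \<bullet> e1) (b \<bullet> e2)"
  have nA: "norm A = norm a"
    using ip[OF a(1), of a] by (simp add: A_def cmod_def norm_eq_sqrt_inner power2_eq_square)
  have nB: "norm B = norm b"
    using ip[OF b(1), of b] by (simp add: B_def cmod_def norm_eq_sqrt_inner power2_eq_square)
  have AB: "A \<noteq> 0" "B \<noteq> 0" "B / A \<noteq> 0"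
    using nA nB a(2) b(2) by auto
  have "cos (Arg (B / A)) = Re (B / A) / norm (B / A)"
    using AB(3) by (rule cos_Arg)
  also have "\<dots> = ((a \<bullet> b) / (norm a)^2) / (norm b / norm a)"
    unfolding norm_divide Re_divide' nA nB using ip[OF a(1), of b] by (simp add: A_def B_def ac_simps)
  finally show "cos (oriented_angle e1 e2 a b) = (a \<bullet> b) / (norm a * norm b)"
    using a(2) by (simp add: oriented_angle_def A_def B_def power2_eq_square)
  have "sin (Arg (B / A)) = Im (B / A) / norm (B / A)"
    using AB(3) by (rule sin_Arg)
  also have "\<dots> = (((a \<bullet> e1) * (b \<bullet> e2) - (a \<bullet> e2) * (b \<bullet> e1)) / (norm a)^2) / (norm b / norm a)"
    unfolding norm_divide Im_divide' nA nB by (simp add: A_def B_def ac_simps)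
  finally show "sin (oriented_angle e1 e2 a b) =
      ((a \<bullet> e1) * (b \<bullet> e2) - (a \<bullet> e2) * (b \<bullet> e1)) / (norm a * norm b)"
    using a(2) by (simp add: oriented_angle_def A_def B_def power2_eq_square)
qed

text \<open>Strict Cauchy-Schwarz makes \<open>q\<close> and \<open>p\<close> linearly independent, so that the Gram-Schmidt
  frame is defined and continuous.\<close>

lemma continuous_orientation_exists:
  fixes q p :: "real \<Rightarrow> 'a::euclidean_space"
  assumes q: "continuous_on I q" and p: "continuous_on I p"
    and indep: "\<And>t. t \<in> I \<Longrightarrow> \<bar>q t \<bullet> p t\<bar> < norm (q t) * norm (p t)"
  shows "\<exists>e1 e2. continuous_orientation I q p e1 e2"
proof -
  define e1 where "e1 t = sgn (q t)" for t
  define r where "r t = p t - (p t \<bullet> e1 t) *\<^sub>R e1 t" for t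
  define e2 where "e2 t = sgn (r t)" for t
  have q0: "q t \<noteq> 0" if "t \<in> I" for t
    using indep[OF that] by auto
  have n1: "norm (e1 t) = 1" if "t \<in> I" for t
    using q0[OF that] by (simp add: e1_def norm_sgn)
  have qe: "q t = norm (q t) *\<^sub>R e1 t" for t
    by (cases "q t = 0") (simp_all add: e1_def sgn_div_norm)
  have r0: "r t \<noteq> 0" if t: "t \<in> I" for t
  proof
    assume "r t = 0"
    then have pe: "p t = (p t \<bullet> e1 t) *\<^sub>R e1 t" by (simp add: r_def)
    have "norm (p t) = \<bar>p t \<bullet> e1 t\<bar>"
      using n1[OF t] by (subst pe) simp
    moreover have "q t \<bullet> p t = norm (q t) * (p t \<bullet> e1 t)"
      by (subst qe) (simp add: inner_commute)
    ultimately show False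
      using indep[OF t] by (simp add: abs_mult)
  qed
  have c1: "continuous_on I e1"
    unfolding e1_def sgn_div_norm using q0 by (intro continuous_intros q) auto
  have cr: "continuous_on I r"
    unfolding r_def by (intro continuous_intros p c1)
  have c2: "continuous_on I e2"
    unfolding e2_def sgn_div_norm using r0 by (intro continuous_intros cr) auto
  have orth: "e1 t \<bullet> e2 t = 0" if "t \<in> I" for t
    using n1[OF that] by (simp add: e2_def r_def sgn_div_norm inner_simps inner_commute dot_square_norm)
  have "q t \<in> span {e1 t, e2 t}" for t
    by (subst qe) (simp add: span_base span_scale)
  moreover have "p t \<in> span {e1 t, e2 t}" for t
  proof -
    have "p t = (p t \<bullet> e1 t) *\<^sub>R e1 t + norm (r t) *\<^sub>R e2 t"
      by (cases "r t = 0") (simp_all add: e2_def sgn_div_norm, simp_all add: r_def)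
    then show ?thesis
      by (metis insertI1 insertI2 singletonI span_add span_base span_scale)
  qed
  ultimately have "continuous_orientation I q p e1 e2"
    using c1 c2 n1 r0 orth by (simp add: continuous_orientation_def e2_def norm_sgn)
  then show ?thesis by blast
qed

text \<open>The angle itself need not be followed continuously: its absolute value is confined by the
  cosine to an interval inside \<open>(pi/2, pi)\<close>, and its sign is that of its sine, whose numerator is
  continuous and has no zero.\<close>

lemma oriented_angle_constant_side:
  fixes q p :: "real \<Rightarrow> 'a::euclidean_space"
  assumes I: "is_interval I" and q: "continuous_on I q" and p: "continuous_on I p"
    and or: "continuous_orientation I q p e1 e2"
    and c: "- 1 < c" and cos: "\<And>t. t \<in> I \<Longrightarrow> c \<le> (q t \<bullet> p t) / (norm (q t) * norm (p t))"
      "\<And>t. t \<in> I \<Longrightarrow> q t \<bullet> p t < 0"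
  defines "\<alpha> \<equiv> \<lambda>t. oriented_angle (e1 t) (e2 t) (q t) (p t)"
  shows "(\<forall>t\<in>I. \<alpha> t \<in> {pi / 2 <.. arccos c}) \<or> (\<forall>t\<in>I. \<alpha> t \<in> {- arccos c ..< - pi / 2})"
proof -
  have p0: "p t \<noteq> 0" and q0: "q t \<noteq> 0" if "t \<in> I" for t
    using cos(2)[OF that] by auto
  define s where "s t = (q t \<bullet> e1 t) * (p t \<bullet> e2 t) - (q t \<bullet> e2 t) * (p t \<bullet> e1 t)" for t
  have sin: "sin (\<alpha> t) = s t / (norm (q t) * norm (p t))"
    and cos_eq: "cos (\<alpha> t) = (q t \<bullet> p t) / (norm (q t) * norm (p t))" if t: "t \<in> I" for t
    using or t p0 q0 unfolding continuous_orientation_def \<alpha>_def s_def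
    by (auto intro!: cos_oriented_angle sin_oriented_angle)
  have range: "- pi < \<alpha> t \<and> \<alpha> t \<le> pi" for t
    unfolding \<alpha>_def oriented_angle_def by (rule Arg_bounded)
  have abs_angle: "pi / 2 < \<bar>\<alpha> t\<bar> \<and> \<bar>\<alpha> t\<bar> \<le> arccos c \<and> \<bar>\<alpha> t\<bar> < pi" if t: "t \<in> I" for t
  proof -
    have neg: "cos (\<alpha> t) < 0"
      using cos(2)[OF t] p0[OF t] q0[OF t] by (simp add: cos_eq[OF t] divide_neg_pos)
    have ge: "c \<le> cos (\<alpha> t)"
      using cos(1)[OF t] by (simp add: cos_eq[OF t])
    have arc: "\<bar>\<alpha> t\<bar> = arccos (cos (\<alpha> t))"
      using range[of t] by (auto simp: abs_if arccos_cos arccos_cos2)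
    have "arccos 0 < arccos (cos (\<alpha> t))"
      using neg by (intro arccos_less_arccos) auto
    moreover have "arccos (cos (\<alpha> t)) \<le> arccos c"
      using ge c by (intro arccos_le_arccos) auto
    moreover have "arccos (cos (\<alpha> t)) < arccos (-1)"
      using ge c neg by (intro arccos_less_arccos) auto
    ultimately show ?thesis
      using arc by (simp add: arccos_0)
  qed
  have norms: "0 < norm (q t) * norm (p t)" if "t \<in> I" for t
    using p0[OF that] q0[OF that] by simp
  have pos: "0 < \<alpha> t" if t: "t \<in> I" "0 < s t" for t
  proof (rule ccontr)
    assume "\<not> 0 < \<alpha> t"
    then have "sin (\<alpha> t) \<le> 0"
      using range[of t] sin_ge_zero[of "- \<alpha> t"] by simp
    moreover have "0 < sin (\<alpha> t)"
      using sin[OF t(1)] t norms by simp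
    ultimately show False by simp
  qed
  have neg: "\<alpha> t < 0" if t: "t \<in> I" "s t < 0" for t
  proof (rule ccontr)
    assume "\<not> \<alpha> t < 0"
    then have "sin (\<alpha> t) \<ge> 0"
      using range[of t] sin_ge_zero[of "\<alpha> t"] by simp
    moreover have "sin (\<alpha> t) < 0"
      using sin[OF t(1)] t norms by (simp add: divide_neg_pos)
    ultimately show False by simp
  qed
  have s0: "s t \<noteq> 0" if t: "t \<in> I" for t
  proof
    assume "s t = 0"
    then have "sin \<bar>\<alpha> t\<bar> = 0"
      using sin[OF t] by (simp add: abs_if)
    moreover have "0 < sin \<bar>\<alpha> t\<bar>"
      using abs_angle[OF t] by (intro sin_gt_zero) auto
    ultimately show False by simp
  qed
  have "continuous_on I s"
    using or unfolding s_def continuous_orientation_def by (auto intro!: continuous_intros p q)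
  then have "is_interval (s ` I)"
    using I by (metis connected_continuous_image is_interval_connected_1)
  then have "(\<forall>t\<in>I. 0 < s t) \<or> (\<forall>t\<in>I. s t < 0)"
    using s0 by (smt (verit) image_iff mem_is_interval_1_I)
  moreover have "\<alpha> t \<in> {pi / 2 <.. arccos c}" if "t \<in> I" "0 < s t" for t
    using pos[OF that] abs_angle[OF that(1)] by simp
  moreover have "\<alpha> t \<in> {- arccos c ..< - pi / 2}" if "t \<in> I" "s t < 0" for t
    using neg[OF that] abs_angle[OF that(1)] by simp
  ultimately show ?thesis
    by blast
qed

section \<open>Singular arcs of the two-body problem\<close>

text \<open>Two differentiations of the constant \<open>|p\<^sub>v|\<^sup>2\<close>.  They hold at every time of the arc, endpoints
  included, because \<open>p\<^sub>v\<close> and \<open>p\<^sub>q\<close> are continuously differentiable on closed subintervals.\<close>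

lemma singular_arc_conditions:
  fixes z :: "real \<Rightarrow> 'a::euclidean_space cotangent"
  assumes ext: "extremal two_body T z \<rho> w" and sing: "singular_arc T z I" and t: "t \<in> I"
    and z: "z t = (q, v, pq, pv)"
  shows "norm pv = 1" "q \<noteq> 0" "pq \<bullet> pv = 0" "kepler_hess q pv \<bullet> pv = pq \<bullet> pq"
proof -
  define Q PQ PV where "Q s = fst (z s)" and "PQ s = fst (snd (snd (z s)))"
    and "PV s = snd (snd (snd (z s)))" for s
  have IT: "I \<subseteq> {0..T}" and intI: "is_interval I"
    and unit: "\<And>s. s \<in> I \<Longrightarrow> norm (PV s) = 1"
    using sing by (auto simp: singular_arc_def H1_def PV_def case_prod_beta)
  have Q0: "Q s \<noteq> 0" if "s \<in> I" for s
    using ext IT that by (auto simp: extremal_def pos_def Q_def case_prod_beta)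
  show "norm pv = 1" "q \<noteq> 0"
    using unit[OF t] Q0[OF t] z by (auto simp: PV_def Q_def)
  have sol: "caratheodory_solution (\<lambda>t. ham_field (\<lambda>y. H0 two_body y + \<rho> t * H1 y)) 0 T z"
    using ext by (simp add: extremal_def)
  \<comment> \<open>A nondegenerate closed interval around \<open>t\<close>, one-sided if \<open>t\<close> is an endpoint of the arc, so that
    derivatives within it are unique.\<close>
  obtain a b where ab: "a < b" "t \<in> {a..b}" "{a..b} \<subseteq> I"
  proof -
    obtain a0 b0 where 0: "a0 \<in> I" "b0 \<in> I" "a0 < b0"
      using sing by (auto simp: singular_arc_def)
    have "min t a0 \<in> I" "max t b0 \<in> I"
      using 0 t by (auto simp: min_def max_def)
    then have "{min t a0..max t b0} \<subseteq> I"
      using mem_is_interval_1_I[OF intI] by (meson atLeastAtMost_iff subsetI)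
    then show thesis
      using 0 by (intro that[of "min t a0" "max t b0"]) auto
  qed
  have sub: "{a..b} \<subseteq> {0..T}" using ab IT by blast
  have field: "ham_field (\<lambda>y. H0 two_body y + \<rho> s * H1 y) (z s) =
      (fst (snd (z s)), - (recip_norm (Q s) ^ 3 *\<^sub>R Q s) + (\<rho> s * recip_norm (PV s)) *\<^sub>R PV s,
       kepler_hess (Q s) (PV s), - PQ s)" if s: "s \<in> {a..b}" for s
  proof -
    have sI: "s \<in> I" using ab(3) s by blast
    then have "PV s \<noteq> 0" using unit by force
    then show ?thesis
      using ham_field_control[OF Q0[OF sI], of "PV s" 1 "\<rho> s" "fst (snd (z s))" "PQ s"]
      by (simp add: Q_def PV_def PQ_def)
  qed
  have contz: "continuous_on {a..b} z"
    using caratheodory_continuous[OF sol] sub by (rule continuous_on_subset)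
  have cont: "continuous_on {a..b} Q" "continuous_on {a..b} PQ" "continuous_on {a..b} PV"
    unfolding Q_def PQ_def PV_def by (intro continuous_intros contz)+
  have dPV: "(PV has_vector_derivative - PQ s) (at s within {a..b})" if s: "s \<in> {a..b}" for s
    unfolding PV_def
  proof (rule caratheodory_component_derivative[OF sol _ sub _ _ s])
    show "bounded_linear (\<lambda>z :: 'a cotangent. snd (snd (snd z)))"
      by (intro bounded_linear_snd_comp bounded_linear_ident)
    show "continuous_on {a..b} (\<lambda>s. - PQ s)"
      by (intro continuous_intros cont)
  qed (simp only: field snd_conv)
  have dPQ: "(PQ has_vector_derivative kepler_hess (Q s) (PV s)) (at s within {a..b})"
    if s: "s \<in> {a..b}" for s
    unfolding PQ_def
  proof (rule caratheodory_component_derivative[OF sol _ sub _ _ s])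
    show "bounded_linear (\<lambda>z :: 'a cotangent. fst (snd (snd z)))"
      by (intro bounded_linear_fst_comp bounded_linear_snd_comp bounded_linear_ident)
    show "continuous_on {a..b} (\<lambda>s. kepler_hess (Q s) (PV s))"
      unfolding kepler_hess_def recip_norm_def using Q0 ab(3) by (intro continuous_intros cont) auto
  qed (simp only: field fst_conv snd_conv)
  have dinner: "((\<lambda>s. f s \<bullet> g s) has_vector_derivative (f s \<bullet> g' + f' \<bullet> g s)) (at s within {a..b})"
    if "(f has_vector_derivative f') (at s within {a..b})" "(g has_vector_derivative g') (at s within {a..b})"
    for f g :: "real \<Rightarrow> 'a" and f' g' s
    using has_derivative_inner[OF that[unfolded has_vector_derivative_def]]
    by (simp add: has_vector_derivative_def distrib_left)
  have orth: "PQ s \<bullet> PV s = 0" if s: "s \<in> {a..b}" for s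
  proof -
    have "PV s \<bullet> - PQ s + - PQ s \<bullet> PV s = 0"
      using ab unit by (intro derivative_zero_of_constant[OF dinner[OF dPV[OF s] dPV[OF s]] s, of 1])
        (auto simp: dot_square_norm)
    then show ?thesis by (simp add: inner_commute)
  qed
  have "PQ t \<bullet> - PQ t + kepler_hess (Q t) (PV t) \<bullet> PV t = 0"
    using ab orth by (intro derivative_zero_of_constant[OF dinner[OF dPQ dPV], of t 0]) auto
  then show "pq \<bullet> pv = 0" "kepler_hess q pv \<bullet> pv = pq \<bullet> pq"
    using orth[OF ab(2)] z by (auto simp: Q_def PQ_def PV_def)
qed

text \<open>With \<open>c\<close> the radial cosine, \<open>V''(q)(p, p) = (1 - 3 c\<^sup>2) / |q|\<^sup>3\<close> and
  \<open>H10001 = c (9 - 15 c\<^sup>2) / |q|\<^sup>4\<close>.  The first sign condition confines \<open>c\<^sup>2\<close> to \<open>[0, 1/3]\<close>, where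
  the second one reads \<open>c < 0\<close>.\<close>

lemma radial_cosine_bounds:
  fixes q p :: "'a::euclidean_space"
  assumes "norm p = 1" "q \<noteq> 0"
    and curv: "0 \<le> kepler_hess q p \<bullet> p"
    and leg: "H10001 two_body (q, v, pq, p) < 0"
  shows "- 1 / sqrt 3 \<le> (q \<bullet> p) / norm q" "q \<bullet> p < 0"
proof -
  define c where "c = (q \<bullet> p) / norm q"
  define u where "u = recip_norm q"
  have u: "0 < u" using assms by (simp add: u_def recip_norm_def)
  have pp: "p \<bullet> p = 1" using assms by (simp add: dot_square_norm)
  have p0: "p \<noteq> 0" "recip_norm p = 1" using assms by (auto simp: recip_norm_def)
  have cu: "c = (q \<bullet> p) * u" by (simp add: c_def u_def recip_norm_def divide_inverse)
  have "kepler_hess q p \<bullet> p = u ^ 3 * (1 - 3 * c\<^sup>2)"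
    by (simp add: kepler_hess_def inner_diff_left pp cu flip: u_def) (simp add: algebra_simps power_numeral_reduce)
  then have c2: "c\<^sup>2 \<le> 1 / 3"
    using curv u by (simp add: zero_le_mult_iff)
  then have "\<bar>c\<bar> \<le> sqrt (1 / 3)"
    by (metis real_sqrt_abs real_sqrt_le_iff)
  then have "- (1 / sqrt 3) \<le> c"
    unfolding real_sqrt_divide real_sqrt_one by linarith
  then show "- 1 / sqrt 3 \<le> (q \<bullet> p) / norm q"
    by (simp add: c_def)
  have "H10001 two_body (q, v, pq, p) = u ^ 4 * (c * (9 - 15 * c\<^sup>2))"
    by (simp add: H10001_eq assms p0 kepler_third_def pp cu flip: u_def) (simp add: algebra_simps power_numeral_reduce)
  then have "c * (9 - 15 * c\<^sup>2) < 0"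
    using leg u by (simp add: mult_less_0_iff)
  then have "c < 0"
    using c2 by (auto simp: mult_less_0_iff)
  then show "q \<bullet> p < 0"
    using assms by (simp add: c_def divide_less_0_iff)
qed

theorem corollary1:
  fixes x0 :: "(real ^ 'm) \<times> (real ^ 'm)"
    and Xf :: "((real ^ 'm) \<times> (real ^ 'm)) set"
    and tf :: real
    and z :: "real \<Rightarrow> (real ^ 'm) cotangent"
    and \<rho> :: "real \<Rightarrow> real"
    and w :: "real \<Rightarrow> real ^ 'm"
    and I :: "real set"
    and \<alpha>\<^sub>0 :: real
  defines "\<alpha>\<^sub>0 \<equiv> arccos (- 1 / sqrt 3)"
  assumes dim: "CARD('m) \<ge> 2"
    and x0: "x0 \<in> state_space" "x0 \<notin> Xf"
    and Xf: "Xf \<subseteq> state_space" "submanifold Xf" "flow_invariant (drift two_body) state_space Xf"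
    and tf: "transfer_times two_body x0 Xf \<noteq> {}" "tf > Inf (transfer_times two_body x0 Xf)"
    and minimizing: "minimizing two_body x0 Xf tf (\<lambda>t. state (z t)) (\<lambda>t. \<rho> t *\<^sub>R w t)"
    and extremal: "extremal two_body tf z \<rho> w"
    and singular: "singular_arc tf z I"
    and order_two: "order_two two_body z I"
    and legendre: "\<forall>t\<in>I. H10001 two_body (z t) \<le> 0"
  shows "(\<exists>e1 e2. continuous_orientation I (\<lambda>t. pos (z t)) (\<lambda>t. pv_of (z t)) e1 e2) \<and>
    (\<forall>e1 e2 \<alpha>. continuous_orientation I (\<lambda>t. pos (z t)) (\<lambda>t. pv_of (z t)) e1 e2 \<longrightarrow>
       (\<forall>t\<in>I. \<alpha> t = oriented_angle (e1 t) (e2 t) (pos (z t)) (pv_of (z t))) \<longrightarrow>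
       (\<forall>t\<in>I. \<alpha> t \<in> {pi / 2 <.. \<alpha>\<^sub>0}) \<or> (\<forall>t\<in>I. \<alpha> t \<in> {- \<alpha>\<^sub>0 ..< - pi / 2}))"
proof -
  define q p where "q t = pos (z t)" and "p t = pv_of (z t)" for t
  have arc: "norm (p t) = 1 \<and> q t \<noteq> 0 \<and> - 1 / sqrt 3 \<le> (q t \<bullet> p t) / norm (q t) \<and> q t \<bullet> p t < 0" if t: "t \<in> I" for t
  proof -
    obtain q' v pq p' where zt: "z t = (q', v, pq, p')" by (metis prod_cases4)
    note c = singular_arc_conditions[OF extremal singular t zt]
    have "H10001 two_body (q', v, pq, p') < 0"
      using order_two legendre t zt by (force simp: order_two_def)
    then show ?thesis
      using c radial_cosine_bounds[of p' q' v pq] zt by (simp add: q_def p_def pos_def pv_of_def)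
  qed
  have sqrt3: "1 / sqrt 3 < (1 :: real)"
    by simp
  have contz: "continuous_on I z"
    using extremal singular caratheodory_continuous continuous_on_subset
    unfolding extremal_def singular_arc_def by blast
  have cont: "continuous_on I q" "continuous_on I p"
    unfolding q_def p_def pos_def pv_of_def case_prod_beta by (intro continuous_intros contz)+
  have indep: "\<bar>q t \<bullet> p t\<bar> < norm (q t) * norm (p t)" if "t \<in> I" for t
  proof -
    have "- 1 < (q t \<bullet> p t) / norm (q t)"
      using arc[OF that] sqrt3 by linarith
    then have "- norm (q t) < q t \<bullet> p t"
      using arc[OF that] by (simp add: less_divide_eq)
    then show ?thesis
      using arc[OF that] by simp
  qed
  have side: "(\<forall>t\<in>I. oriented_angle (e1 t) (e2 t) (q t) (p t) \<in> {pi / 2 <.. arccos (- 1 / sqrt 3)})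
      \<or> (\<forall>t\<in>I. oriented_angle (e1 t) (e2 t) (q t) (p t) \<in> {- arccos (- 1 / sqrt 3) ..< - pi / 2})"
    if or: "continuous_orientation I q p e1 e2" for e1 e2
  proof (rule oriented_angle_constant_side[OF _ cont or])
    show "is_interval I" using singular by (simp add: singular_arc_def)
    show "- 1 < - 1 / sqrt (3 :: real)" using sqrt3 by linarith
    fix t assume t: "t \<in> I"
    show "q t \<bullet> p t < 0" using arc[OF t] by blast
    show "- 1 / sqrt 3 \<le> (q t \<bullet> p t) / (norm (q t) * norm (p t))" using arc[OF t] by simp
  qed
  show ?thesis
    unfolding \<alpha>\<^sub>0_def
  proof (intro conjI allI impI)
    show "\<exists>e1 e2. continuous_orientation I (\<lambda>t. pos (z t)) (\<lambda>t. pv_of (z t)) e1 e2"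
      using continuous_orientation_exists[OF cont indep] unfolding q_def p_def .
  next
    fix e1 e2 \<alpha>
    assume "continuous_orientation I (\<lambda>t. pos (z t)) (\<lambda>t. pv_of (z t)) e1 e2"
      and \<alpha>: "\<forall>t\<in>I. \<alpha> t = oriented_angle (e1 t) (e2 t) (pos (z t)) (pv_of (z t))"
    then show "(\<forall>t\<in>I. \<alpha> t \<in> {pi / 2 <.. arccos (- 1 / sqrt 3)})
      \<or> (\<forall>t\<in>I. \<alpha> t \<in> {- arccos (- 1 / sqrt 3) ..< - pi / 2})"
      using side[unfolded q_def p_def, of e1 e2] by metis
  qed
qed

end
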